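(* Let $\pi_1\colon\Omega_1\to\Omega_0$ and $\pi_2\colon\Omega_2\to\Omega_0$ be bundles of probability schemes, and let $\theta_i\colon\Omega_1\otimes_{\Omega_0}\Omega_2\to\Omega_i$ ($i=1,2$) be the coordinate projections from their fiber product. Then the base-change (Beck--Chevalley) identity holds: $$\theta_{1*}\theta_2^{\sharp}=\pi_1^{\sharp}\pi_{2*}$$ as maps $\mathbb{R}^{\Omega_2}\to\mathbb{R}^{\Omega_1}$.
   Context: A (probability) scheme is a finite set $\Omega$ with a function $\mathrm{pr}\colon\Omega\to(0,\infty)$ such that $\sum_{\omega}\mathrm{pr}(\omega)=1$. A bundle is a map $\pi\colon\Omega\to\Omega'$ of schemes with $\mathrm{pr}'(\omega')=\sum_{\omega\in\pi^{-1}(\omega')}\mathrm{pr}(\omega)$ for all $\omega'\in\Omega'$ (hence surjective). The pullback is $\pi^{\sharp}\colon\mathbb{R}^{\Omega'}\to\mathbb{R}^{\Omega}$, $\pi^{\sharp}(Z)=Z\circ\pi$, and the transfer $\pi_*\colon\mathbb{R}^{\Omega}\to\mathbb{R}^{\Omega'}$ is $(\pi_*X)(\omega')=\sum_{\omega\in\pi^{-1}(\omega')}X(\omega)$. The fiber product $\Omega_1\otimes_{\Omega_0}\Omega_2$ is the scheme on the set $\{\langle\omega_1,\omega_2\rangle:\pi_1(\omega_1)=\pi_2(\omega_2)\}$ with distribution $\langle\omega_1,\omega_2\rangle\mapsto\mathrm{pr}_1(\omega_1)\mathrm{pr}_2(\omega_2)/\mathrm{pr}_0(\pi_1(\omega_1))$.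 *)

theory Defs
  imports Complex_Main "HOL-Library.FuncSet"
begin

record 'a scheme =
  points :: "'a set"
  pr :: "'a \<Rightarrow> real"

definition is_scheme :: "'a scheme \<Rightarrow> bool" where
  "is_scheme S \<longleftrightarrow>
     finite (points S) \<and> (\<forall>\<omega>\<in>points S. 0 < pr S \<omega>) \<and> (\<Sum>\<omega>\<in>points S. pr S \<omega>) = 1"

definition fiber :: "'a scheme \<Rightarrow> ('a \<Rightarrow> 'b) \<Rightarrow> 'b \<Rightarrow> 'a set" where
  "fiber S \<pi> \<omega>' = {\<omega>\<in>points S. \<pi> \<omega> = \<omega>'}"

definition is_bundle :: "'a scheme \<Rightarrow> 'b scheme \<Rightarrow> ('a \<Rightarrow> 'b) \<Rightarrow> bool" where
  "is_bundle S S' \<pi> \<longleftrightarrow>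
     is_scheme S \<and> is_scheme S' \<and> \<pi> \<in> points S \<rightarrow> points S' \<and>
     (\<forall>\<omega>'\<in>points S'. pr S' \<omega>' = (\<Sum>\<omega>\<in>fiber S \<pi> \<omega>'. pr S \<omega>))"

text \<open>The real functions on the point set of a scheme. As the point set is only a subset of the
  ambient type, functions are taken extensional (equal to \<open>undefined\<close> off the point set), so that
  equality in this set is equality of functions on the points. The maps between these function sets
  below are extensional for the same reason.\<close>

definition rvs :: "'a scheme \<Rightarrow> ('a \<Rightarrow> real) set" where
  "rvs S = points S \<rightarrow>\<^sub>E UNIV"

definition pullback :: "'a scheme \<Rightarrow> 'b scheme \<Rightarrow> ('a \<Rightarrow> 'b) \<Rightarrow> ('b \<Rightarrow> real) \<Rightarrow> ('a \<Rightarrow> real)" where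
  "pullback S S' \<pi> = (\<lambda>Z\<in>rvs S'. \<lambda>\<omega>\<in>points S. Z (\<pi> \<omega>))"

definition transfer :: "'a scheme \<Rightarrow> 'b scheme \<Rightarrow> ('a \<Rightarrow> 'b) \<Rightarrow> ('a \<Rightarrow> real) \<Rightarrow> ('b \<Rightarrow> real)" where
  "transfer S S' \<pi> = (\<lambda>X\<in>rvs S. \<lambda>\<omega>'\<in>points S'. \<Sum>\<omega>\<in>fiber S \<pi> \<omega>'. X \<omega>)"

definition fiber_product ::
  "'c scheme \<Rightarrow> 'a scheme \<Rightarrow> 'b scheme \<Rightarrow> ('a \<Rightarrow> 'c) \<Rightarrow> ('b \<Rightarrow> 'c) \<Rightarrow> ('a \<times> 'b) scheme" where
  "fiber_product S0 S1 S2 \<pi>1 \<pi>2 =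
     \<lparr> points = {(\<omega>1, \<omega>2). \<omega>1 \<in> points S1 \<and> \<omega>2 \<in> points S2 \<and> \<pi>1 \<omega>1 = \<pi>2 \<omega>2},
       pr = (\<lambda>(\<omega>1, \<omega>2). pr S1 \<omega>1 * pr S2 \<omega>2 / pr S0 (\<pi>1 \<omega>1)) \<rparr>"

lemma pullback_in_rvs:
  assumes "is_bundle S S' \<pi>"
  shows "pullback S S' \<pi> \<in> rvs S' \<rightarrow>\<^sub>E rvs S"
  by (auto simp: pullback_def rvs_def)

lemma transfer_in_rvs:
  assumes "is_bundle S S' \<pi>"
  shows "transfer S S' \<pi> \<in> rvs S \<rightarrow>\<^sub>E rvs S'"
  by (auto simp: transfer_def rvs_def)

lemma bundle_surj:
  assumes "is_bundle S S' \<pi>"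
  shows "\<pi> ` points S = points S'"
proof
  show "\<pi> ` points S \<subseteq> points S'" using assms by (auto simp: is_bundle_def)
  show "points S' \<subseteq> \<pi> ` points S"
  proof
    fix y assume y: "y \<in> points S'"
    then have "0 < (\<Sum>\<omega>\<in>fiber S \<pi> y. pr S \<omega>)"
      using assms by (auto simp: is_bundle_def is_scheme_def)
    then have "fiber S \<pi> y \<noteq> {}" by auto
    then show "y \<in> \<pi> ` points S" by (auto simp: fiber_def)
  qed
qed

lemma scheme_total:
  assumes "finite (points P)" "\<And>\<omega>. \<omega> \<in> points P \<Longrightarrow> 0 < pr P \<omega>" "is_scheme S"
    "\<theta> \<in> points P \<rightarrow> points S"
    "\<And>a. a \<in> points S \<Longrightarrow> (\<Sum>\<omega>\<in>fiber P \<theta> a. pr P \<omega>) = pr S a"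
  shows "is_scheme P" "is_bundle P S \<theta>"
proof -
  have "(\<Sum>\<omega>\<in>points P. pr P \<omega>) = (\<Sum>a\<in>points S. \<Sum>\<omega>\<in>fiber P \<theta> a. pr P \<omega>)"
    unfolding fiber_def
    by (rule sum.group[symmetric]) (use assms in \<open>auto simp: is_scheme_def\<close>)
  also have "\<dots> = 1" using assms by (simp add: is_scheme_def)
  finally show 1: "is_scheme P" using assms by (simp add: is_scheme_def)
  show "is_bundle P S \<theta>" using 1 assms by (simp add: is_bundle_def)
qed

lemma fiber_product_bundles:
  assumes b1: "is_bundle S1 S0 \<pi>1" and b2: "is_bundle S2 S0 \<pi>2"
  shows "is_scheme (fiber_product S0 S1 S2 \<pi>1 \<pi>2)"
    and "is_bundle (fiber_product S0 S1 S2 \<pi>1 \<pi>2) S1 fst"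
    and "is_bundle (fiber_product S0 S1 S2 \<pi>1 \<pi>2) S2 snd"
proof -
  let ?P = "fiber_product S0 S1 S2 \<pi>1 \<pi>2"
  have fin: "finite (points ?P)"
    by (rule finite_subset[of _ "points S1 \<times> points S2"])
      (use b1 b2 in \<open>auto simp: fiber_product_def is_bundle_def is_scheme_def\<close>)
  have pos: "0 < pr ?P \<omega>" if "\<omega> \<in> points ?P" for \<omega>
    using that b1 b2 by (auto simp: fiber_product_def is_bundle_def is_scheme_def Pi_iff)
  have s1: "(\<Sum>\<omega>\<in>fiber ?P fst a. pr ?P \<omega>) = pr S1 a" if a: "a \<in> points S1" for a
  proof -
    have p: "\<pi>1 a \<in> points S0" "0 < pr S0 (\<pi>1 a)"
      using a b1 by (auto simp: is_bundle_def is_scheme_def)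
    have "fiber ?P fst a = Pair a ` fiber S2 \<pi>2 (\<pi>1 a)"
      using a by (auto simp: fiber_def fiber_product_def)
    then have "(\<Sum>\<omega>\<in>fiber ?P fst a. pr ?P \<omega>)
        = (\<Sum>b\<in>fiber S2 \<pi>2 (\<pi>1 a). pr S1 a * pr S2 b / pr S0 (\<pi>1 a))"
      by (simp add: sum.reindex inj_on_def fiber_product_def)
    also have "\<dots> = pr S1 a * (\<Sum>b\<in>fiber S2 \<pi>2 (\<pi>1 a). pr S2 b) / pr S0 (\<pi>1 a)"
      by (simp add: sum_distrib_left sum_divide_distrib)
    also have "\<dots> = pr S1 a" using p b2 by (simp add: is_bundle_def)
    finally show ?thesis .
  qed
  have s2: "(\<Sum>\<omega>\<in>fiber ?P snd b. pr ?P \<omega>) = pr S2 b" if b: "b \<in> points S2" for b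
  proof -
    have p: "\<pi>2 b \<in> points S0" "0 < pr S0 (\<pi>2 b)"
      using b b2 by (auto simp: is_bundle_def is_scheme_def)
    have "fiber ?P snd b = (\<lambda>a. (a, b)) ` fiber S1 \<pi>1 (\<pi>2 b)"
      using b by (auto simp: fiber_def fiber_product_def)
    then have "(\<Sum>\<omega>\<in>fiber ?P snd b. pr ?P \<omega>)
        = (\<Sum>a\<in>fiber S1 \<pi>1 (\<pi>2 b). pr S1 a * pr S2 b / pr S0 (\<pi>1 a))"
      by (simp add: sum.reindex inj_on_def fiber_product_def)
    also have "\<dots> = (\<Sum>a\<in>fiber S1 \<pi>1 (\<pi>2 b). pr S1 a * pr S2 b / pr S0 (\<pi>2 b))"
      by (rule sum.cong) (auto simp: fiber_def)
    also have "\<dots> = (\<Sum>a\<in>fiber S1 \<pi>1 (\<pi>2 b). pr S1 a) * pr S2 b / pr S0 (\<pi>2 b)"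
      by (simp add: sum_distrib_right sum_divide_distrib)
    also have "\<dots> = pr S2 b" using p b1 by (simp add: is_bundle_def)
    finally show ?thesis .
  qed
  have "is_scheme S1" "is_scheme S2" using b1 b2 by (simp_all add: is_bundle_def)
  moreover have "fst \<in> points ?P \<rightarrow> points S1" "snd \<in> points ?P \<rightarrow> points S2"
    by (auto simp: fiber_product_def)
  ultimately show "is_scheme ?P" "is_bundle ?P S1 fst" "is_bundle ?P S2 snd"
    using scheme_total[OF fin pos] s1 s2 by blast+
qed

end

theory Submission
  imports Defs
begin

text \<open>The fiber of \<open>fst\<close> over a point \<open>a\<close> is a copy of the fiber of
  \<open>\<pi>2\<close> over \<open>\<pi>1 a\<close>, with \<open>snd\<close> as the identifying
  bijection (\<open>fiber_fiber_product_fst\<close>). Hence, evaluated at \<open>X\<close> and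
  \<open>a\<close>, both composites sum \<open>X\<close> over the points of \<open>S2\<close> lying
  over \<open>\<pi>1 a\<close>.\<close>

lemma fiber_fiber_product_fst:
  assumes "a \<in> points S1"
  shows "fiber (fiber_product S0 S1 S2 \<pi>1 \<pi>2) fst a = Pair a ` fiber S2 \<pi>2 (\<pi>1 a)"
  using assms by (auto simp: fiber_def fiber_product_def)

theorem mainTheorem7:
  fixes S0 :: "'c scheme" and S1 :: "'a scheme" and S2 :: "'b scheme"
    and \<pi>1 :: "'a \<Rightarrow> 'c" and \<pi>2 :: "'b \<Rightarrow> 'c"
  assumes "is_bundle S1 S0 \<pi>1" and "is_bundle S2 S0 \<pi>2"
  shows "compose (rvs S2)
           (transfer (fiber_product S0 S1 S2 \<pi>1 \<pi>2) S1 fst)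
           (pullback (fiber_product S0 S1 S2 \<pi>1 \<pi>2) S2 snd) =
         compose (rvs S2) (pullback S1 S0 \<pi>1) (transfer S2 S0 \<pi>2)"
proof -
  let ?P = "fiber_product S0 S1 S2 \<pi>1 \<pi>2"
  have "transfer ?P S1 fst (pullback ?P S2 snd X) = pullback S1 S0 \<pi>1 (transfer S2 S0 \<pi>2 X)"
    if X: "X \<in> rvs S2" for X
  proof -
    \<comment> \<open>\<open>transfer\<close> and \<open>pullback\<close> are
      \<open>undefined\<close> off \<open>rvs\<close>, so the outer map on each side unfolds only
      once its argument is known to lie there.\<close>
    have Y: "pullback ?P S2 snd X \<in> rvs ?P"
      using PiE_mem[OF pullback_in_rvs[OF fiber_product_bundles(3)[OF assms]] X] .
    have Z: "transfer S2 S0 \<pi>2 X \<in> rvs S0"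
      using PiE_mem[OF transfer_in_rvs[OF assms(2)] X] .
    have "(\<Sum>\<omega>\<in>fiber ?P fst a. pullback ?P S2 snd X \<omega>) = transfer S2 S0 \<pi>2 X (\<pi>1 a)"
      if a: "a \<in> points S1" for a
    proof -
      \<comment> \<open>This ensures that the transfer takes the value of the fiber sum at
        \<open>\<pi>1 a\<close>, not the default \<open>undefined\<close>.\<close>
      have "\<pi>1 a \<in> points S0" using assms(1) a by (auto simp: is_bundle_def)
      have "(\<Sum>\<omega>\<in>fiber ?P fst a. pullback ?P S2 snd X \<omega>) = (\<Sum>\<omega>\<in>fiber ?P fst a. X (snd \<omega>))"
        using X by (intro sum.cong) (auto simp: pullback_def fiber_def)
      \<comment> \<open>Reindexing along the injection \<open>Pair a\<close>, which
        \<open>snd\<close> undoes.\<close>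
      also have "\<dots> = (\<Sum>b\<in>fiber S2 \<pi>2 (\<pi>1 a). X b)"
        by (simp add: fiber_fiber_product_fst[OF a] sum.reindex inj_on_def)
      also have "\<dots> = transfer S2 S0 \<pi>2 X (\<pi>1 a)"
        using X \<open>\<pi>1 a \<in> points S0\<close> by (simp add: transfer_def)
      finally show ?thesis .
    qed
    then have "transfer ?P S1 fst (pullback ?P S2 snd X)
        = (\<lambda>a\<in>points S1. transfer S2 S0 \<pi>2 X (\<pi>1 a))"
      using Y by (simp add: transfer_def[of ?P] cong: restrict_cong)
    then show ?thesis using Z by (simp add: pullback_def)
  qed
  then show ?thesis by (auto simp: compose_def intro: restrict_ext)
qed

end
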